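(* Let $S$ be a set of $n-1$ points on a horizontal line $h$, let $x$ be a point not on $h$, and let $S'=S\cup\{x\}$ (so $|S'|=n$). Let $2\le l<k\le n$ be integers. Then $IJ(S',k,l)$ is connected if and only if $n\ge 3k-2l-1$ or $n=k$.
   Context: A subset $I$ of a finite point set $Q$ in the plane is an island if $I=Q\cap C$ for some convex set $C$; a $k$-island has exactly $k$ elements. $IJ(Q,k,l)$ is the graph whose vertices are the $k$-islands of $Q$, two adjacent if their intersection has exactly $l$ elements. *)

theory Defs
  imports "HOL-Analysis.Analysis" "Graph_Theory.Graph_Theory"
begin

definition island :: "(real \<times> real) set \<Rightarrow> (real \<times> real) set \<Rightarrow> bool" where
  "island Q I \<longleftrightarrow> (\<exists>C. convex C \<and> I = Q \<inter> C)"

definition k_island :: "(real \<times> real) set \<Rightarrow> nat \<Rightarrow> (real \<times> real) set \<Rightarrow> bool" where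
  "k_island Q k I \<longleftrightarrow> island Q I \<and> finite I \<and> card I = k"

text \<open>An undirected graph is represented as a symmetric digraph, each edge giving two arcs.\<close>

definition IJ :: "(real \<times> real) set \<Rightarrow> nat \<Rightarrow> nat \<Rightarrow> (real \<times> real) set pair_pre_digraph" where
  "IJ Q k l =
    \<lparr> pverts = {I. k_island Q k I},
      parcs = {(I, J). k_island Q k I \<and> k_island Q k J \<and> I \<noteq> J \<and>
                 finite (I \<inter> J) \<and> card (I \<inter> J) = l} \<rparr>"

lemma pair_graph_IJ:
  assumes "finite Q"
  shows "pair_graph (IJ Q k l)"
proof -
  have v: "{I. k_island Q k I} \<subseteq> Pow Q"
    by (auto simp: k_island_def island_def)
  then have fv: "finite {I. k_island Q k I}"
    using assms by (meson finite_Pow_iff finite_subset)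
  have "parcs (IJ Q k l) \<subseteq> {I. k_island Q k I} \<times> {I. k_island Q k I}"
    by (auto simp: IJ_def)
  then have fa: "finite (parcs (IJ Q k l))"
    using fv by (meson finite_SigmaI finite_subset)
  show ?thesis
    by unfold_locales (use fv fa in \<open>auto simp: IJ_def symmetric_def sym_def Int_commute\<close>)
qed

end

theory Submission
  imports Defs
begin

text \<open>
  The \<open>k\<close>-islands are the runs of \<open>k\<close> consecutive points of \<open>S\<close>, and the runs of \<open>k - 1\<close>
  consecutive points together with \<open>x\<close>. Listing them alternately gives vertices
  \<open>0, \<dots>, 2(n - k)\<close>, and since \<open>l \<ge> 2\<close>, two of them are adjacent iff their indices differ by
  \<open>D\<close> or \<open>D - 1\<close>, where \<open>D = 2(k - l)\<close>. If \<open>n - k \<ge> D - 1\<close>, every \<open>u\<close> is joined to \<open>u + 1\<close>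
  through \<open>u + D\<close> or \<open>u + 1 - D\<close>; otherwise vertex \<open>min (D - 2) (2(n - k))\<close> is isolated.
\<close>

section \<open>Preliminaries on intervals of indices, convex hulls and reachability\<close>

lemma finite_order_convex_nat_eq_interval:
  fixes J :: "nat set"
  assumes "finite J" and "J \<noteq> {}"
    and conv: "\<And>a b t. a \<in> J \<Longrightarrow> b \<in> J \<Longrightarrow> a \<le> t \<Longrightarrow> t \<le> b \<Longrightarrow> t \<in> J"
  shows "J = {Min J..<Min J + card J}"
proof -
  have "{Min J..Max J} \<subseteq> J"
    using conv[OF Min_in[OF assms(1,2)] Max_in[OF assms(1,2)]] by (simp add: subset_iff)
  moreover have "J \<subseteq> {Min J..Max J}"
    using assms(1) by auto
  ultimately have eq: "J = {Min J..Max J}"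
    by blast
  have "Min J \<le> Max J"
    using assms(1,2) by simp
  moreover have "card J = Suc (Max J) - Min J"
    by (subst eq) simp
  ultimately have "{Min J..Max J} = {Min J..<Min J + card J}"
    by auto
  with eq show ?thesis by (rule trans)
qed

lemma obtain_strict_mono_on_enum:
  fixes A :: "'a::linorder set"
  assumes "finite A"
  obtains e where "strict_mono_on {..<card A} e" and "e ` {..<card A} = A"
proof
  show "strict_mono_on {..<card A} ((!) (sorted_list_of_set A))"
    by (auto intro!: strict_mono_onI sorted_wrt_nth_less[of "(<)"])
  show "(!) (sorted_list_of_set A) ` {..<card A} = A"
    using nth_image[of "card A" "sorted_list_of_set A"] assms
    by (simp add: lessThan_atLeast0)
qed

text \<open>Each hull point is a convex combination of \<open>x\<close> and some \<open>b\<close> in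
  \<open>A\<close>; its height is \<open>c\<close> only if \<open>x\<close> has weight zero. The
  cone over \<open>A\<close> thus gains no point on the line.\<close>

lemma convex_hull_insert_Int_level:
  fixes x :: "real \<times> real"
  assumes "convex A" and "A \<subseteq> {p. snd p = c}" and "snd x \<noteq> c"
  shows "convex hull (insert x A) \<inter> {p. snd p = c} = A"
proof
  show "A \<subseteq> convex hull (insert x A) \<inter> {p. snd p = c}"
    using assms(2) hull_subset[of "insert x A" convex] by blast
  show "convex hull (insert x A) \<inter> {p. snd p = c} \<subseteq> A"
  proof
    fix z assume z: "z \<in> convex hull (insert x A) \<inter> {p. snd p = c}"
    then have "A \<noteq> {}"
      using assms(3) by auto
    with z assms(1) obtain u v b where uv: "u + v = 1" and b: "b \<in> A"
      and zeq: "z = u *\<^sub>R x + v *\<^sub>R b"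
      by (simp add: convex_hull_insert hull_same del: scaleR_Pair split_paired_Ex) blast
    have "c = u * snd x + v * c"
      using z zeq b assms(2) by auto
    moreover have "v = 1 - u"
      using uv by simp
    ultimately have "u * (snd x - c) = 0"
      by (auto simp: algebra_simps)
    then have "u = 0"
      using assms(3) by simp
    then show "z \<in> A"
      using uv zeq b by simp
  qed
qed

text \<open>The library notion is strong connectivity of the symmetric closure. The arcs are already
  symmetric, so it reduces to reachability along them.\<close>

lemma connected_IJ_iff:
  assumes "finite Q"
  shows "Digraph_Component.connected (with_proj (IJ Q k l)) \<longleftrightarrow>
    pverts (IJ Q k l) \<noteq> {} \<and>
    (\<forall>I \<in> pverts (IJ Q k l). \<forall>J \<in> pverts (IJ Q k l).
      (I, J) \<in> rtrancl_on (pverts (IJ Q k l)) (parcs (IJ Q k l)))"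
proof -
  interpret pair_graph "IJ Q k l"
    using assms by (rule pair_graph_IJ)
  show ?thesis
    unfolding Digraph_Component.connected_def strongly_connected_def
    by (simp add: adj_mk_symmetric_eq[OF sym_arcs] reachable_def)
qed

section \<open>Runs of consecutive points on a line, and an apex off it\<close>

locale collinear_points_and_apex =
  fixes e :: "nat \<Rightarrow> real" and c :: real and m :: nat and x :: "real \<times> real"
  assumes mono: "strict_mono_on {..<m} e"
    and apex: "snd x \<noteq> c"
begin

text \<open>Only the values of \<open>e\<close> below \<open>m\<close> are controlled, so facts
  about the size or convexity of a run carry the side condition
  \<open>i + r \<le> m\<close>.\<close>

definition run :: "nat \<Rightarrow> nat \<Rightarrow> (real \<times> real) set" where
  "run i r = (\<lambda>t. (e t, c)) ` {i..<i + r}"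

definition points :: "(real \<times> real) set" where
  "points = insert x (run 0 m)"

text \<open>Interleaving the islands that contain \<^term>\<open>x\<close> (even index) with those that do not
  (odd index) makes adjacency depend only on the difference of the indices.\<close>

definition nth_island :: "nat \<Rightarrow> nat \<Rightarrow> (real \<times> real) set" where
  "nth_island k u = (if even u then insert x (run (u div 2) (k - 1)) else run (u div 2) k)"

lemma inj_on_point: "inj_on (\<lambda>t. (e t, c)) {..<m}"
  using strict_mono_on_imp_inj_on[OF mono] by (auto simp: inj_on_def)

lemma le_iff: "i < m \<Longrightarrow> j < m \<Longrightarrow> e i \<le> e j \<longleftrightarrow> i \<le> j"
  using strict_mono_on_leD[OF mono, of i j] strict_mono_onD[OF mono, of j i]
  by (cases "i \<le> j") auto

lemma finite_run [simp]: "finite (run i r)"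
  by (simp add: run_def)

lemma apex_notin_run [simp]: "x \<notin> run i r"
  using apex by (auto simp: run_def)

lemma finite_points: "finite points"
  by (simp add: points_def)

lemma card_run: "i + r \<le> m \<Longrightarrow> card (run i r) = r"
  unfolding run_def by (subst card_image) (auto intro: inj_on_subset[OF inj_on_point])

text \<open>Injectivity of the listing moves the intersection to index intervals. For disjoint runs
  the truncated difference is 0.\<close>

lemma card_run_Int_run:
  assumes "i + r \<le> m" and "j + s \<le> m"
  shows "card (run i r \<inter> run j s) = min (i + r) (j + s) - max i j"
proof -
  have "run i r \<inter> run j s = (\<lambda>t. (e t, c)) ` ({i..<i + r} \<inter> {j..<j + s})"
    unfolding run_def using assms
    by (intro inj_on_image_Int[OF inj_on_point, symmetric]) auto
  also have "{i..<i + r} \<inter> {j..<j + s} = {max i j..<min (i + r) (j + s)}"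
    by auto
  also have "card ((\<lambda>t. (e t, c)) ` \<dots>) = card {max i j..<min (i + r) (j + s)}"
    using assms by (intro card_image inj_on_subset[OF inj_on_point]) auto
  finally show ?thesis by simp
qed

section \<open>Islands as runs, with or without the apex\<close>

lemma convex_Int_run:
  assumes "convex C"
  obtains i where "i + card (run 0 m \<inter> C) \<le> m"
    and "run 0 m \<inter> C = run i (card (run 0 m \<inter> C))"
proof (cases "run 0 m \<inter> C = {}")
  case True
  then show ?thesis
    using that[of 0] by (simp add: run_def)
next
  case False
  define J where "J = {t. t < m \<and> (e t, c) \<in> C}"
  have img: "run 0 m \<inter> C = (\<lambda>t. (e t, c)) ` J"
    by (auto simp: J_def run_def)
  have "J = {Min J..<Min J + card J}"
  proof (rule finite_order_convex_nat_eq_interval)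
    show "finite J" by (simp add: J_def)
    show "J \<noteq> {}" using False img by auto
    fix a b t assume ab: "a \<in> J" "b \<in> J" "a \<le> t" "t \<le> b"
    then have "t < m" by (auto simp: J_def)
    with ab have "e a \<le> e t" "e t \<le> e b"
      by (auto simp: J_def le_iff)
    then have "(e t, c) \<in> closed_segment (e a, c) (e b, c)"
      by (subst closed_segment_same_snd) (auto simp: closed_segment_eq_real_ivl)
    with assms ab show "t \<in> J"
      using \<open>t < m\<close> by (auto simp: J_def convex_contains_segment)
  qed
  moreover have "J \<subseteq> {..<m}" by (auto simp: J_def)
  moreover have "card (run 0 m \<inter> C) = card J"
    unfolding img by (intro card_image inj_on_subset[OF inj_on_point]) fact
  moreover have "J \<noteq> {}" using False img by auto
  ultimately have "run 0 m \<inter> C = run (Min J) (card (run 0 m \<inter> C))"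
    and "Min J + card J \<le> m"
    using img ivl_subset[of "Min J" "Min J + card J" 0 m]
    by (auto simp: run_def lessThan_atLeast0)
  with \<open>card (run 0 m \<inter> C) = card J\<close> show ?thesis
    using that by metis
qed

text \<open>The witness for a nonempty run is the segment from its first to its last point. Staying
  on the line, it avoids \<open>x\<close> and can serve as the base of a cone with apex
  \<open>x\<close>.\<close>

lemma run_eq_Int_convex:
  assumes "i + r \<le> m"
  obtains A where "convex A" and "A \<subseteq> {p. snd p = c}" and "run i r = run 0 m \<inter> A"
proof (cases "r = 0")
  case True
  then show ?thesis using that[of "{}"] by (simp add: run_def)
next
  case False
  let ?A = "{e i..e (i + r - 1)} \<times> {c}"
  have "run i r = run 0 m \<inter> ?A"
    using False assms by (auto simp: run_def le_iff)
  then show ?thesis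
    by (intro that[of ?A]) (auto intro: convex_Times convex_closed_interval)
qed

lemma island_run:
  assumes "i + r \<le> m"
  shows "island points (run i r)"
proof -
  obtain A where "convex A" "A \<subseteq> {p. snd p = c}" "run i r = run 0 m \<inter> A"
    using assms by (rule run_eq_Int_convex)
  then show ?thesis
    using apex by (auto simp: island_def points_def)
qed

text \<open>The cone with base \<open>A\<close> and apex \<open>x\<close> meets the line only in
  \<open>A\<close>, so it captures exactly the run and \<open>x\<close>.\<close>

lemma island_insert_run:
  assumes "i + r \<le> m"
  shows "island points (insert x (run i r))"
proof -
  obtain A where A: "convex A" "A \<subseteq> {p. snd p = c}" "run i r = run 0 m \<inter> A"
    using assms by (rule run_eq_Int_convex)
  have "run 0 m \<subseteq> {p. snd p = c}" by (auto simp: run_def)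
  with A(3) convex_hull_insert_Int_level[OF A(1,2) apex]
  have "insert x (run i r) = points \<inter> convex hull (insert x A)"
    using hull_inc[of x "insert x A" convex] unfolding points_def by blast
  then show ?thesis
    unfolding island_def by (metis convex_convex_hull)
qed

text \<open>A run of \<open>r\<close> points from \<open>i\<close> fits iff
  \<open>i + r \<le> m\<close>: \<open>r = k - 1\<close> gives the even indices up to the bound,
  \<open>r = k\<close> the odd ones between them.\<close>

lemma k_islands_eq:
  assumes "2 \<le> k" and "k \<le> m + 1"
  shows "{I. k_island points k I} = nth_island k ` {..2 * (m + 1 - k)}"
proof (intro set_eqI iffI)
  fix I assume "I \<in> nth_island k ` {..2 * (m + 1 - k)}"
  then obtain u where u: "u \<le> 2 * (m + 1 - k)" and I: "I = nth_island k u" by auto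
  show "I \<in> {I. k_island points k I}"
  proof (cases "even u")
    case True
    then have "u div 2 + (k - 1) \<le> m" using u assms by auto
    then show ?thesis
      using True I assms card_run island_insert_run by (simp add: nth_island_def k_island_def)
  next
    case False
    \<comment> \<open>An odd \<open>u\<close> lies strictly below the even bound, which leaves room
      for one more point.\<close>
    then have "u div 2 + k \<le> m" using u assms by presburger
    then show ?thesis
      using False I assms card_run island_run by (simp add: nth_island_def k_island_def)
  qed
next
  fix I assume "I \<in> {I. k_island points k I}"
  then obtain C where C: "convex C" "I = points \<inter> C" "card I = k"
    by (auto simp: k_island_def island_def)
  obtain i where i: "i + card (run 0 m \<inter> C) \<le> m"
    "run 0 m \<inter> C = run i (card (run 0 m \<inter> C))"
    using C(1) by (rule convex_Int_run)
  show "I \<in> nth_island k ` {..2 * (m + 1 - k)}"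
  proof (cases "x \<in> C")
    case True
    then have I: "I = insert x (run 0 m \<inter> C)"
      using C(2) by (auto simp: points_def)
    then have "card (run 0 m \<inter> C) = k - 1"
      using C(3) by simp
    then have "I = nth_island k (2 * i)" "2 * i \<le> 2 * (m + 1 - k)"
      using i I assms by (auto simp: nth_island_def)
    then show ?thesis by blast
  next
    case False
    then have I: "I = run 0 m \<inter> C"
      using C(2) by (auto simp: points_def)
    then have "I = nth_island k (2 * i + 1)" "2 * i + 1 \<le> 2 * (m + 1 - k)"
      using i C(3) assms by (auto simp: nth_island_def)
    then show ?thesis by blast
  qed
qed

section \<open>Adjacency in terms of indices\<close>

text \<open>Each parity case is an explicit overlap of two runs. Two even indices also share
  \<open>x\<close>, so their runs must share \<open>l - 1\<close> points; as
  \<open>l \<ge> 2\<close> this is positive, and disjoint runs never count.\<close>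

lemma card_nth_island_Int:
  assumes "2 \<le> l" and "l < k" and "k \<le> m + 1"
    and "u \<le> v" and "v \<le> 2 * (m + 1 - k)"
  shows "card (nth_island k u \<inter> nth_island k v) = l \<longleftrightarrow>
    v = u + 2 * (k - l) \<or> v + 1 = u + 2 * (k - l)"
proof -
  define i j where "i = u div 2" and "j = v div 2"
  consider (ee) "u = 2 * i" "v = 2 * j" | (eo) "u = 2 * i" "v = 2 * j + 1"
    | (oe) "u = 2 * i + 1" "v = 2 * j" | (oo) "u = 2 * i + 1" "v = 2 * j + 1"
    unfolding i_def j_def by (metis dvd_mult_div_cancel odd_two_times_div_two_succ)
  then show ?thesis
  proof cases
    case ee
    have "card (nth_island k u \<inter> nth_island k v) = Suc (card (run i (k - 1) \<inter> run j (k - 1)))"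
      by (simp add: ee nth_island_def)
    also have "card (run i (k - 1) \<inter> run j (k - 1)) = min (i + (k - 1)) (j + (k - 1)) - max i j"
      using assms ee by (intro card_run_Int_run) auto
    finally show ?thesis using assms ee by auto
  next
    case eo
    have "card (nth_island k u \<inter> nth_island k v) = card (run i (k - 1) \<inter> run j k)"
      by (simp add: eo nth_island_def)
    also have "\<dots> = min (i + (k - 1)) (j + k) - max i j"
      using assms eo by (intro card_run_Int_run) auto
    finally show ?thesis using assms eo by auto
  next
    case oe
    have "card (nth_island k u \<inter> nth_island k v) = card (run i k \<inter> run j (k - 1))"
      by (simp add: oe nth_island_def)
    also have "\<dots> = min (i + k) (j + (k - 1)) - max i j"
      using assms oe by (intro card_run_Int_run) auto
    finally show ?thesis using assms oe by (auto simp: min_def max_def)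
  next
    case oo
    have "card (nth_island k u \<inter> nth_island k v) = card (run i k \<inter> run j k)"
      by (simp add: oo nth_island_def)
    also have "\<dots> = min (i + k) (j + k) - max i j"
      using assms oo by (intro card_run_Int_run) auto
    finally show ?thesis using assms oo by auto
  qed
qed

lemma arc_nth_island_iff:
  assumes "2 \<le> l" and "l < k" and "k \<le> m + 1"
    and "u \<le> 2 * (m + 1 - k)" and "v \<le> 2 * (m + 1 - k)"
  shows "(nth_island k u, nth_island k v) \<in> parcs (IJ points k l) \<longleftrightarrow>
    v = u + 2 * (k - l) \<or> v + 1 = u + 2 * (k - l) \<or>
    u = v + 2 * (k - l) \<or> u + 1 = v + 2 * (k - l)"
proof -
  have isl: "k_island points k (nth_island k u)" "k_island points k (nth_island k v)"
    using k_islands_eq[of k] assms by auto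
  \<comment> \<open>An island meets itself in \<open>k > l\<close> points, so an intersection of
    size \<open>l\<close> forces distinct islands.\<close>
  then have "card (nth_island k u \<inter> nth_island k v) = l \<Longrightarrow> nth_island k u \<noteq> nth_island k v"
    using assms(2) by (auto simp: k_island_def)
  with isl have "(nth_island k u, nth_island k v) \<in> parcs (IJ points k l) \<longleftrightarrow>
    card (nth_island k u \<inter> nth_island k v) = l"
    by (auto simp: IJ_def k_island_def)
  also have "\<dots> \<longleftrightarrow> v = u + 2 * (k - l) \<or> v + 1 = u + 2 * (k - l) \<or>
    u = v + 2 * (k - l) \<or> u + 1 = v + 2 * (k - l)"
  proof (cases "u \<le> v")
    case True
    then show ?thesis using card_nth_island_Int[of l k u v] assms by auto
  next
    case False
    then show ?thesis using card_nth_island_Int[of l k v u] assms by (auto simp: Int_commute)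
  qed
  finally show ?thesis .
qed

section \<open>Connectedness and its failure\<close>

lemma pverts_IJ_points:
  assumes "2 \<le> k" and "k \<le> m + 1"
  shows "pverts (IJ points k l) = nth_island k ` {..2 * (m + 1 - k)}"
  using k_islands_eq[OF assms] by (simp add: IJ_def)

lemma reachable_first_island:
  assumes "2 \<le> l" and "l < k" and "k \<le> m + 1"
    and large: "m + 1 = k \<or> 2 * (k - l) \<le> m + 2 - k"
    and "u \<le> 2 * (m + 1 - k)"
  shows "(nth_island k 0, nth_island k u) \<in>
    rtrancl_on (pverts (IJ points k l)) (parcs (IJ points k l))"
  using \<open>u \<le> 2 * (m + 1 - k)\<close>
proof (induction u)
  case 0
  then show ?case using pverts_IJ_points[of k l] assms by auto
next
  case (Suc u)
  let ?M = "2 * (m + 1 - k)"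
  define d where "d = k - l"
  have d: "0 < d" using assms by (simp add: d_def)
  define w where "w = (if u + 2 * d \<le> ?M then u + 2 * d else u + 1 - 2 * d)"
  \<comment> \<open>\<open>Suc u\<close> is within the bound, so there is more than one island and
    \<open>m + 1 = k\<close> is excluded.\<close>
  have big: "2 * d \<le> m + 2 - k" "k \<le> m"
    using large Suc.prems assms(3) by (auto simp: d_def)
  have w: "w \<le> ?M"
    using Suc.prems by (auto simp: w_def)
  \<comment> \<open>If \<open>u + 2 * d\<close> exceeds \<open>?M\<close>, then
    \<open>?M \<ge> 2 * (2 * d - 1)\<close> yields \<open>u + 1 \<ge> 2 * d\<close>, so the
    subtraction in \<open>w\<close> is exact.\<close>
  have "w = u + 2 * d \<or> u + 1 = w + 2 * d"
    using big by (auto simp: w_def)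
  then have "(nth_island k u, nth_island k w) \<in> parcs (IJ points k l)"
    "(nth_island k w, nth_island k (Suc u)) \<in> parcs (IJ points k l)"
    using Suc.prems w assms by (auto simp: arc_nth_island_iff d_def)
  moreover have "nth_island k w \<in> pverts (IJ points k l)"
    "nth_island k (Suc u) \<in> pverts (IJ points k l)"
    using Suc.prems w pverts_IJ_points[of k l] assms by auto
  moreover have "(nth_island k 0, nth_island k u) \<in>
    rtrancl_on (pverts (IJ points k l)) (parcs (IJ points k l))"
    using Suc by simp
  ultimately show ?case
    by (meson rtrancl_on_into_rtrancl_on)
qed

lemma isolated_island:
  assumes "2 \<le> l" and "l < k" and "k \<le> m"
    and small: "m + 2 - k < 2 * (k - l)"
  shows "\<not> Digraph_Component.connected (with_proj (IJ points k l))"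
proof
  \<comment> \<open>Being at most \<open>2 * (k - l) - 2\<close>, \<open>u\<close> has no neighbour
    below. Above, either \<open>u\<close> is the last index, or the nearest candidate
    \<open>4 * (k - l) - 3\<close> exceeds the last index by \<open>small\<close>.\<close>
  define u where "u = 2 * min (k - l - 1) (m + 1 - k)"
  let ?V = "pverts (IJ points k l)" and ?E = "parcs (IJ points k l)"
  have V: "?V = nth_island k ` {..2 * (m + 1 - k)}"
    using assms by (intro pverts_IJ_points) auto
  have u: "u \<le> 2 * (m + 1 - k)"
    by (simp add: u_def)
  have no_arc: "(nth_island k u, J) \<notin> ?E" if J: "J \<in> ?V" for J
  proof -
    obtain v where v: "v \<le> 2 * (m + 1 - k)" "J = nth_island k v"
      using J V by auto
    have "\<not> (v = u + 2 * (k - l) \<or> v + 1 = u + 2 * (k - l) \<or>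
      u = v + 2 * (k - l) \<or> u + 1 = v + 2 * (k - l))"
      using small v(1) assms by (auto simp: u_def min_def split: if_splits)
    then show ?thesis
      using arc_nth_island_iff[of l k u v] u v assms by auto
  qed
  assume "Digraph_Component.connected (with_proj (IJ points k l))"
  moreover have "nth_island k u \<in> ?V" "nth_island k 1 \<in> ?V"
    using V u assms by auto
  ultimately have "(nth_island k u, nth_island k 1) \<in> rtrancl_on ?V ?E"
    using connected_IJ_iff[OF finite_points] by blast
  \<comment> \<open>A walk cannot leave an island without arcs. Island 1 exists as
    \<open>k \<le> m\<close>, and \<open>x\<close> tells the two apart because \<open>u\<close> is
    even.\<close>
  then have "nth_island k 1 = nth_island k u"
    by (induction rule: rtrancl_on_induct) (use no_arc in auto)
  moreover have "x \<in> nth_island k u" "x \<notin> nth_island k 1"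
    by (auto simp: nth_island_def u_def)
  ultimately show False by simp
qed

lemma connected_IJ_points_iff:
  assumes "2 \<le> l" and "l < k" and "k \<le> m + 1"
  shows "Digraph_Component.connected (with_proj (IJ points k l)) \<longleftrightarrow>
    m + 1 = k \<or> 2 * (k - l) \<le> m + 2 - k"
proof
  assume "Digraph_Component.connected (with_proj (IJ points k l))"
  then show "m + 1 = k \<or> 2 * (k - l) \<le> m + 2 - k"
    using isolated_island[of l k] assms by (cases "k \<le> m") (auto simp: not_less[symmetric])
next
  assume "m + 1 = k \<or> 2 * (k - l) \<le> m + 2 - k"
  note reach = reachable_first_island[OF assms this]
  interpret pair_graph "IJ points k l"
    using finite_points by (rule pair_graph_IJ)
  let ?R = "rtrancl_on (pverts (IJ points k l)) (parcs (IJ points k l))"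
  \<comment> \<open>Symmetry lets any two islands be joined by way of island 0.\<close>
  have "sym ?R"
    using sym_arcs by (intro rtrancl_on_sym) (simp add: symmetric_def)
  then have "(nth_island k u, nth_island k v) \<in> ?R"
    if "u \<le> 2 * (m + 1 - k)" "v \<le> 2 * (m + 1 - k)" for u v
    using reach[OF that(1)] reach[OF that(2)] by (meson rtrancl_on_trans symD)
  then show "Digraph_Component.connected (with_proj (IJ points k l))"
    using assms by (auto simp: connected_IJ_iff[OF finite_points] pverts_IJ_points)
qed

end

section \<open>Transfer from the sorted listing to the given point set\<close>

theorem theorem4:
  fixes S S' h :: "(real \<times> real) set" and x :: "real \<times> real" and c :: real
    and n k l :: nat
  assumes "h = {p. snd p = c}"
    and "finite S" and "card S = n - 1" and "S \<subseteq> h"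
    and "x \<notin> h"
    and "S' = S \<union> {x}"
    and "2 \<le> l" and "l < k" and "k \<le> n"
  shows "Digraph_Component.connected (with_proj (IJ S' k l)) \<longleftrightarrow>
           int n \<ge> 3 * int k - 2 * int l - 1 \<or> n = k"
proof -
  \<comment> \<open>All points of \<open>S\<close> have height \<open>c\<close>, so their abscissas
    determine them and can be sorted into \<open>e\<close>.\<close>
  have "inj_on fst S"
    using assms(1,4) by (intro inj_onI prod_eqI) auto
  then have "card (fst ` S) = n - 1"
    using assms(3) by (simp add: card_image)
  moreover have "finite (fst ` S)" using assms(2) by simp
  ultimately obtain e where mono: "strict_mono_on {..<n - 1} e"
    and img: "e ` {..<n - 1} = fst ` S"
    using obtain_strict_mono_on_enum by metis
  interpret collinear_points_and_apex e c "n - 1" x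
    using mono assms(1,5) by unfold_locales auto
  have "run 0 (n - 1) = (\<lambda>a. (a, c)) ` fst ` S"
    unfolding img[symmetric] by (auto simp: run_def)
  also have "\<dots> = S"
    using assms(1,4) by force
  finally have "S' = points"
    using assms(6) unfolding points_def by simp
  then have "Digraph_Component.connected (with_proj (IJ S' k l)) \<longleftrightarrow>
      n - 1 + 1 = k \<or> 2 * (k - l) \<le> n - 1 + 2 - k"
    using connected_IJ_points_iff[of l k] assms(7-9) by simp
  \<comment> \<open>From \<open>2 \<le> l < k \<le> n\<close> no natural subtraction truncates, and
    the inequality rearranges over the integers.\<close>
  also have "\<dots> \<longleftrightarrow> int n \<ge> 3 * int k - 2 * int l - 1 \<or> n = k"
    using assms(7-9) by auto
  finally show ?thesis .
qed

end
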